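(* If $\psi = \varphi_w$ is a primitive Sturmian substitution such that $w \in \{b,\beta\}^* \cup \{b,\alpha\}^* \cup \{a,\beta\}^* \cup \{a,\alpha\}^*$, then $\psi$ is closeable under derivation.
   Context: Morphisms on $\{0,1\}^*$: $\varphi_a: 0\mapsto 0, 1 \mapsto 10$; $\varphi_b: 0 \mapsto 0, 1\mapsto 01$; $\varphi_\alpha: 0\mapsto 01, 1\mapsto 1$; $\varphi_\beta: 0\mapsto 10, 1 \mapsto 1$; for $w=w_0\cdots w_{m-1}$, $\varphi_w = \varphi_{w_0}\circ\cdots\circ\varphi_{w_{m-1}}$. A morphism is primitive if some power maps every letter to a word containing every letter. A substitution is a morphism $\psi$ with a letter $c$ such that $\psi(c)=cx$, $x$ nonempty, $|\psi^n(c)|\to\infty$. Derived word: for a uniformly recurrent word $\mathbf{u}$ and a factor $v$, a return word of $v$ is a factor $r$ such that $rv$ is a factor in which $v$ occurs exactly twice (as prefix and suffix); if $r_0,\dots,r_k$ are all return words, write $\mathbf{u}=p\,r_{s_0}r_{s_1}\cdots$ with $|p|$ the first occurrence of $v$; $\mathbf{d}_{\mathbf{u}}(v)=s_0s_1s_2\cdots$, up to permutation of letters. A finite set $M$ of primitive substitutions is closed under derivation if for every $\varphi\in M$, every fixed point $\mathbf{u}$ of $\varphi$ and every factor $v$ of $\mathbf{u}$, $\mathbf{d}_{\mathbf{u}}(v)$ is fixed by some primitive substitution $\psi\in M$. A primitive substitution is closeable under derivation if it belongs to some finite set closed under derivation. *)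

theory Defs
  imports Main "HOL-Library.Infinite_Set"
begin

text \<open>A morphism on the finite alphabet {0..<d} is represented by the list
  of images f = [f(0), ..., f(d-1)], so d = length f.\<close>

definition is_morphism :: "nat list list \<Rightarrow> bool" where
  "is_morphism f \<longleftrightarrow> (\<forall>x\<in>set f. set x \<subseteq> {0..<length f})"

definition morph_word :: "nat list list \<Rightarrow> nat list \<Rightarrow> nat list" where
  "morph_word f w = concat (map (\<lambda>a. f ! a) w)"

definition morph_pow :: "nat list list \<Rightarrow> nat \<Rightarrow> nat list \<Rightarrow> nat list" where
  "morph_pow f n = (morph_word f ^^ n)"

definition compose :: "nat list list \<Rightarrow> nat list list \<Rightarrow> nat list list" where
  "compose f g = map (morph_word f) g"

definition primitive :: "nat list list \<Rightarrow> bool" where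
  "primitive f \<longleftrightarrow> is_morphism f \<and> length f > 0 \<and>
     (\<exists>n\<ge>1. \<forall>a<length f. \<forall>b<length f. b \<in> set (morph_pow f n [a]))"

definition is_substitution :: "nat list list \<Rightarrow> bool" where
  "is_substitution f \<longleftrightarrow> is_morphism f \<and>
     (\<exists>c<length f. \<exists>x. x \<noteq> [] \<and> f ! c = c # x \<and>
        filterlim (\<lambda>n. length (morph_pow f n [c])) at_top sequentially)"

text \<open>Image of an infinite word under a morphism; correct for non-erasing morphisms
  (the only ones used below, since primitive morphisms are non-erasing).\<close>
definition apply_inf :: "nat list list \<Rightarrow> (nat \<Rightarrow> nat) \<Rightarrow> nat \<Rightarrow> nat" where
  "apply_inf f u i = concat (map (\<lambda>k. f ! u k) [0..<Suc i]) ! i"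

definition fixed_point :: "nat list list \<Rightarrow> (nat \<Rightarrow> nat) \<Rightarrow> bool" where
  "fixed_point f u \<longleftrightarrow> (\<forall>i. u i < length f) \<and> apply_inf f u = u"

definition subword :: "(nat \<Rightarrow> nat) \<Rightarrow> nat \<Rightarrow> nat \<Rightarrow> nat list" where
  "subword u i j = map u [i..<j]"

definition is_factor :: "nat list \<Rightarrow> (nat \<Rightarrow> nat) \<Rightarrow> bool" where
  "is_factor v u \<longleftrightarrow> (\<exists>i. subword u i (i + length v) = v)"

definition occs_fin :: "nat list \<Rightarrow> nat list \<Rightarrow> nat set" where
  "occs_fin v x = {i. i + length v \<le> length x \<and> take (length v) (drop i x) = v}"

definition occs :: "nat list \<Rightarrow> (nat \<Rightarrow> nat) \<Rightarrow> nat set" where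
  "occs v u = {i. subword u i (i + length v) = v}"

definition return_words :: "(nat \<Rightarrow> nat) \<Rightarrow> nat list \<Rightarrow> nat list set" where
  "return_words u v = {r. is_factor (r @ v) u \<and> r \<noteq> [] \<and>
                          occs_fin v (r @ v) = {0, length r}}"

text \<open>The n-th return word in the decomposition u = p r_{s0} r_{s1} ..., where |p| is
  the first occurrence of v (occurrences enumerated increasingly).\<close>
definition ret_seq :: "(nat \<Rightarrow> nat) \<Rightarrow> nat list \<Rightarrow> nat \<Rightarrow> nat list" where
  "ret_seq u v n = subword u (enumerate (occs v u) n) (enumerate (occs v u) (Suc n))"

text \<open>d_u(v) is fixed (up to a permutation of letters) by psi: some injective
  coding sigma of the return words turns the sequence s_0 s_1 ... into a fixed point.\<close>
definition derived_fixed_by :: "(nat \<Rightarrow> nat) \<Rightarrow> nat list \<Rightarrow> nat list list \<Rightarrow> bool" where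
  "derived_fixed_by u v \<psi> \<longleftrightarrow>
     (\<exists>\<sigma>. inj_on \<sigma> (return_words u v) \<and> fixed_point \<psi> (\<lambda>n. \<sigma> (ret_seq u v n)))"

definition closed_under_derivation :: "nat list list set \<Rightarrow> bool" where
  "closed_under_derivation M \<longleftrightarrow> finite M \<and>
     (\<forall>\<phi>\<in>M. primitive \<phi> \<and> is_substitution \<phi>) \<and>
     (\<forall>\<phi>\<in>M. \<forall>u. fixed_point \<phi> u \<longrightarrow>
        (\<forall>v. is_factor v u \<longrightarrow> (\<exists>\<psi>\<in>M. derived_fixed_by u v \<psi>)))"

definition closeable_under_derivation :: "nat list list \<Rightarrow> bool" where
  "closeable_under_derivation \<psi> \<longleftrightarrow> (\<exists>M. \<psi> \<in> M \<and> closed_under_derivation M)"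

datatype gen = Ga | Gb | Galpha | Gbeta

fun gen_morph :: "gen \<Rightarrow> nat list list" where
  "gen_morph Ga = [[0], [1,0]]"
| "gen_morph Gb = [[0], [0,1]]"
| "gen_morph Galpha = [[0,1], [1]]"
| "gen_morph Gbeta = [[1,0], [1]]"

fun phi :: "gen list \<Rightarrow> nat list list" where
  "phi [] = [[0], [1]]"
| "phi (x # w) = compose (gen_morph x) (phi w)"

end

theory Submission
  imports Defs "HOL-Library.Omega_Words_Fun"
begin

text \<open>Let \<open>c\<close> be the (characteristic) fixed point of \<open>phi w\<close> for a word \<open>w\<close> over
  \<open>b, \<beta>\<close>. Replacing \<open>\<beta>\<close> by \<open>\<alpha>\<close>, or \<open>b\<close> by \<open>a\<close>, or both, gives conjugate morphisms with fixed
  points \<open>0c\<close>, respectively \<open>1c\<close>, respectively \<open>01c\<close> and \<open>10c\<close>. A factor \<open>v\<close> of such a word \<open>yc\<close>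
  is desubstituted along the first letter of \<open>w\<close>: writing \<open>c = \<phi>(c')\<close>, either \<open>yc = \<phi>(yc')\<close>, or
  \<open>yc\<close> is \<open>\<phi>(yc')\<close> without its first letter, and the return words of \<open>v\<close> are, up to conjugation,
  the \<open>\<phi>\<close>-images of the return words of a shorter factor of \<open>yc'\<close> or of its tail. Here \<open>c'\<close> is
  fixed by \<open>phi\<close> of a rotation of \<open>w\<close>, and a tail of \<open>yc'\<close> again has an admissible \<open>y\<close>. The
  descent ends at the empty factor, whose derived word is the word itself. So the morphisms
  \<open>phi w'\<close> with \<open>w'\<close> of the same length and over one of the four pairs of generators form a
  finite set closed under derivation.\<close>

subsection \<open>Images of infinite words\<close>

lemma subword_eq_subsequence: "subword = subsequence"
  by (intro ext) (simp add: subword_def subsequence_def)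

lemma morph_word_Nil [simp]: "morph_word f [] = []"
  and morph_word_Cons [simp]: "morph_word f (a # w) = f ! a @ morph_word f w"
  and morph_word_append [simp]: "morph_word f (w @ w') = morph_word f w @ morph_word f w'"
  by (simp_all add: morph_word_def)

lemma morph_word_compose:
  "set w \<subseteq> {..<length g} \<Longrightarrow> morph_word (compose f g) w = morph_word f (morph_word g w)"
  by (induction w) (auto simp: compose_def)

lemma length_morph_word_ge:
  "\<forall>a\<in>set w. f ! a \<noteq> [] \<Longrightarrow> length w \<le> length (morph_word f w)"
proof (induction w)
  case (Cons a w)
  then have "length (f ! a) > 0" "length w \<le> length (morph_word f w)" by auto
  then show ?case by (simp del: length_greater_0_conv)
qed simp

lemma prefix_le_split: "n \<le> m \<Longrightarrow> prefix m u = prefix n u @ subsequence u n m"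
  using subsequence_append[of u n "m - n"] by simp

text \<open>Images of nested prefixes are nested, so letter \<open>i\<close> can be read off the
  image of any prefix, once that image is long enough, and not only off the one in the
  definition.\<close>

lemma apply_inf_eq_nth:
  assumes "\<And>i. f ! u i \<noteq> []" and "i < length (morph_word f (prefix n u))"
  shows "apply_inf f u i = morph_word f (prefix n u) ! i"
proof -
  have eq: "apply_inf f u i = morph_word f (prefix (Suc i) u) ! i"
    by (simp add: apply_inf_def morph_word_def subsequence_def comp_def)
  have len: "i < length (morph_word f (prefix (Suc i) u))"
    using length_morph_word_ge[of "prefix (Suc i) u" f] assms(1) by (auto simp del: subseq_to_Suc)
  show ?thesis
  proof (cases "n \<le> Suc i")
    case True
    show ?thesis unfolding eq prefix_le_split[OF True] using assms(2) by (simp add: nth_append)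
  next
    case False
    then have le: "Suc i \<le> n" by simp
    show ?thesis
      using len unfolding eq prefix_le_split[OF le] by (simp add: nth_append del: subseq_to_Suc)
  qed
qed

lemma apply_inf_conc:
  assumes "\<And>i. f ! u i \<noteq> []" and "\<And>a. a \<in> set w \<Longrightarrow> f ! a \<noteq> []"
  shows "apply_inf f (w \<frown> u) = morph_word f w \<frown> apply_inf f u"
proof
  fix i
  have ne: "f ! (w \<frown> u) j \<noteq> []" for j
    using assms by (cases "j < length w") auto
  have pre: "prefix (length w + Suc i) (w \<frown> u) = w @ prefix (Suc i) u"
    by (subst prefix_conc_snd) auto
  have len: "i < length (morph_word f (prefix (Suc i) u))"
    using length_morph_word_ge[of "prefix (Suc i) u" f] assms(1) by (auto simp del: subseq_to_Suc)
  have "apply_inf f (w \<frown> u) i = (morph_word f w @ morph_word f (prefix (Suc i) u)) ! i"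
    using apply_inf_eq_nth[of f "w \<frown> u", OF ne, of i "length w + Suc i"] len unfolding pre by simp
  also have "\<dots> = (morph_word f w \<frown> apply_inf f u) i"
  proof (cases "i < length (morph_word f w)")
    case False
    then show ?thesis
      using apply_inf_eq_nth[of f u, OF assms(1), of "i - length (morph_word f w)" "Suc i"] len
      by (simp add: nth_append del: subseq_to_Suc)
  qed (simp add: nth_append)
  finally show "apply_inf f (w \<frown> u) i = (morph_word f w \<frown> apply_inf f u) i" .
qed

text \<open>Excluding empty images gives \<open>n\<close> letters an image of at least
  \<open>n\<close> letters, so that \<open>apply_inf\<close> is the true image.\<close>

definition bin_morph :: "nat list list \<Rightarrow> bool" where
  "bin_morph f \<longleftrightarrow> length f = 2 \<and> is_morphism f \<and> [] \<notin> set f"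

definition binary :: "(nat \<Rightarrow> nat) \<Rightarrow> bool" where
  "binary u \<longleftrightarrow> (\<forall>i. u i < 2)"

lemma binaryD [simp]: "binary u \<Longrightarrow> u i < 2"
  by (simp add: binary_def)

lemma binary_build [simp]: "binary (a ## u) \<longleftrightarrow> a < 2 \<and> binary u"
  unfolding binary_def by (metis build.simps not0_implies_Suc)

lemma binary_conc [simp]: "binary (w \<frown> u) \<longleftrightarrow> set w \<subseteq> {..<2} \<and> binary u"
  by (induction w) auto

lemma binary_suffix [simp]: "binary u \<Longrightarrow> binary (suffix k u)"
  by (simp add: binary_def)

lemma set_subsequence_binary: "binary u \<Longrightarrow> set (subsequence u i j) \<subseteq> {..<2}"
  by auto

lemma bin_morph_nth:
  assumes "bin_morph f" and "a < 2"
  shows "f ! a \<noteq> []" "set (f ! a) \<subseteq> {..<2}"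
proof -
  have "f ! a \<in> set f" using assms by (auto simp: bin_morph_def)
  then show "f ! a \<noteq> []" "set (f ! a) \<subseteq> {..<2}"
    using assms unfolding bin_morph_def is_morphism_def lessThan_atLeast0 by metis+
qed

lemma set_morph_word: "bin_morph f \<Longrightarrow> set w \<subseteq> {..<2} \<Longrightarrow> set (morph_word f w) \<subseteq> {..<2}"
  by (induction w) (use bin_morph_nth in auto)

lemma apply_inf_conc_bin:
  assumes "bin_morph f" "binary u" "set w \<subseteq> {..<2}"
  shows "apply_inf f (w \<frown> u) = morph_word f w \<frown> apply_inf f u"
  using assms bin_morph_nth(1)[OF assms(1)] by (intro apply_inf_conc) auto

lemma apply_inf_build:
  assumes "bin_morph f" "binary u" "a < 2"
  shows "apply_inf f (a ## u) = f ! a \<frown> apply_inf f u"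
  using apply_inf_conc_bin[OF assms(1,2), of "[a]"] assms(3) by simp

lemma apply_inf_prefix_suffix:
  assumes "bin_morph f" "binary u"
  shows "apply_inf f u = morph_word f (prefix n u) \<frown> apply_inf f (suffix n u)"
  using apply_inf_conc_bin[OF assms(1) binary_suffix[OF assms(2)]
      set_subsequence_binary[OF assms(2)], of 0 n n]
  unfolding prefix_suffix[symmetric] .

lemma length_morph_word_prefix_ge:
  assumes "bin_morph f" "binary u"
  shows "n \<le> length (morph_word f (prefix n u))"
  using length_morph_word_ge[of "prefix n u" f] bin_morph_nth(1)[OF assms(1)] assms(2) by auto

lemma apply_inf_nth:
  assumes "bin_morph f" "binary u"
  shows "apply_inf f u i = morph_word f (prefix (Suc i) u) ! i"
  using apply_inf_prefix_suffix[OF assms, of "Suc i"] length_morph_word_prefix_ge[OF assms, of "Suc i"]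
  by (metis Suc_le_eq conc_fst)

lemma binary_apply_inf:
  assumes "bin_morph f" "binary u"
  shows "binary (apply_inf f u)"
  unfolding binary_def
proof
  fix i
  have "apply_inf f u i \<in> set (morph_word f (prefix (Suc i) u))"
    using length_morph_word_prefix_ge[OF assms, of "Suc i"] unfolding apply_inf_nth[OF assms]
    by (metis Suc_le_eq nth_mem)
  then show "apply_inf f u i < 2"
    using set_morph_word[OF assms(1) set_subsequence_binary[OF assms(2)], of 0 "Suc i"] by blast
qed

lemma bin_morph_compose:
  assumes "bin_morph f" "bin_morph g"
  shows "bin_morph (compose f g)"
proof -
  have "morph_word f x \<noteq> [] \<and> set (morph_word f x) \<subseteq> {..<2}" if "x \<in> set g" for x
  proof -
    have x: "x \<noteq> []" "set x \<subseteq> {..<2}"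
      using that assms(2) unfolding bin_morph_def is_morphism_def lessThan_atLeast0 by metis+
    then have "length x \<le> length (morph_word f x)"
      using bin_morph_nth(1)[OF assms(1)] by (intro length_morph_word_ge) auto
    with x show ?thesis using set_morph_word[OF assms(1)] by auto
  qed
  then show ?thesis
    using assms(2) by (fastforce simp: bin_morph_def is_morphism_def compose_def)
qed

lemma apply_inf_compose:
  assumes "bin_morph f" "bin_morph g" "binary u"
  shows "apply_inf (compose f g) u = apply_inf f (apply_inf g u)"
proof
  fix i
  let ?p = "prefix (Suc i) u"
  have p: "set ?p \<subseteq> {..<2}" by (rule set_subsequence_binary[OF assms(3)])
  have eq: "morph_word (compose f g) ?p = morph_word f (morph_word g ?p)"
    using p assms(2) by (intro morph_word_compose) (auto simp: bin_morph_def)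
  have len: "Suc i \<le> length (morph_word (compose f g) ?p)"
    by (intro length_morph_word_prefix_ge bin_morph_compose assms)
  have "apply_inf f (apply_inf g u) =
      morph_word f (morph_word g ?p) \<frown> apply_inf f (apply_inf g (suffix (Suc i) u))"
    using apply_inf_prefix_suffix[OF assms(2,3), of "Suc i"]
      apply_inf_conc_bin[OF assms(1) binary_apply_inf[OF assms(2) binary_suffix[OF assms(3)]]
        set_morph_word[OF assms(2) p], of "Suc i"]
    by simp
  then show "apply_inf (compose f g) u i = apply_inf f (apply_inf g u) i"
    using len apply_inf_nth[OF bin_morph_compose[OF assms(1,2)] assms(3), of i] unfolding eq
    by (simp del: subseq_to_Suc)
qed

section \<open>The generators and their compositions\<close>

lemma bin_morph_gen: "bin_morph (gen_morph x)"
  by (cases x) (auto simp: bin_morph_def is_morphism_def)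

lemma bin_morph_phi: "bin_morph (phi w)"
  by (induction w) (auto simp: bin_morph_compose bin_morph_gen, simp add: bin_morph_def is_morphism_def)

lemma apply_inf_phi_Nil:
  assumes "binary u"
  shows "apply_inf (phi []) u = u"
proof
  fix i
  have "set w \<subseteq> {..<2} \<Longrightarrow> morph_word [[0], [1]] w = w" for w
    by (induction w) (auto simp: less_2_cases_iff)
  then have "morph_word (phi []) (prefix (Suc i) u) = prefix (Suc i) u"
    using set_subsequence_binary[OF assms] unfolding phi.simps by blast
  then show "apply_inf (phi []) u i = u i"
    unfolding apply_inf_nth[OF bin_morph_phi assms] by (simp del: subseq_to_Suc)
qed

lemma binary_phi [simp]: "binary u \<Longrightarrow> binary (apply_inf (phi w) u)"
  by (simp add: binary_apply_inf bin_morph_phi)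

lemma apply_inf_phi_Cons:
  "binary u \<Longrightarrow> apply_inf (phi (x # w)) u = apply_inf (gen_morph x) (apply_inf (phi w) u)"
  by (simp add: apply_inf_compose bin_morph_gen bin_morph_phi)

lemma apply_inf_phi_append:
  "binary u \<Longrightarrow> apply_inf (phi (w @ w')) u = apply_inf (phi w) (apply_inf (phi w') u)"
  by (induction w)
    (simp_all add: apply_inf_phi_Nil[OF binary_phi] apply_inf_phi_Cons del: phi.simps)

subsection \<open>Codings of the sequence of return words\<close>

text \<open>\<open>d\<close> is the derived word up to renaming. Only the pattern of equal and
  distinct return words is recorded, so no labelling has to be carried through the descent.\<close>

definition codes_returns :: "(nat \<Rightarrow> nat) \<Rightarrow> nat list \<Rightarrow> (nat \<Rightarrow> nat) \<Rightarrow> bool" where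
  "codes_returns u v d \<longleftrightarrow> (\<exists>pos. strict_mono pos \<and> range pos = occs v u \<and>
     (\<forall>m n. d m = d n \<longleftrightarrow>
        subsequence u (pos m) (pos (Suc m)) = subsequence u (pos n) (pos (Suc n))))"

section \<open>Occurrences and their enumeration\<close>

lemma occs_iff_suffix: "i \<in> occs v u \<longleftrightarrow> suffix i u = v \<frown> suffix (i + length v) u"
proof
  assume "i \<in> occs v u"
  then have "v = subsequence u i (i + length v)"
    by (simp add: occs_def subword_eq_subsequence)
  then show "suffix i u = v \<frown> suffix (i + length v) u"
    using suffix_subseq_join[of i "i + length v" u] by simp
next
  assume "suffix i u = v \<frown> suffix (i + length v) u"
  then have "prefix (length v) (suffix i u) = v"
    by (metis prefix_conc_length)
  then show "i \<in> occs v u"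
    by (simp add: occs_def subword_eq_subsequence)
qed

lemma occs_iff_nth: "i \<in> occs v u \<longleftrightarrow> (\<forall>j<length v. u (i + j) = v ! j)"
  unfolding occs_def subword_eq_subsequence mem_Collect_eq by (subst list_eq_iff_nth_eq) simp

lemma occsI: "suffix i u = v \<frown> t \<Longrightarrow> i \<in> occs v u"
  by (simp add: occs_iff_nth fun_eq_iff)

lemma is_factor_iff_occs: "is_factor v u \<longleftrightarrow> occs v u \<noteq> {}"
  by (auto simp: is_factor_def occs_def)

lemma Suc_in_occs_build: "Suc i \<in> occs v (a ## u) \<longleftrightarrow> i \<in> occs v u"
  by (simp add: occs_iff_nth)

text \<open>Let \<open>enumerate\<close> take the value \<open>pos k\<close> at \<open>n\<close> and
  the value \<open>pos n\<close> at \<open>l\<close>. Induction rules out \<open>k < n\<close> and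
  \<open>l < n\<close>, and monotonicity squeezes \<open>pos k\<close> between \<open>pos n\<close>
  and \<open>pos n\<close>.\<close>

lemma strict_mono_eq_enumerate:
  assumes "strict_mono (pos :: nat \<Rightarrow> nat)"
  shows "enumerate (range pos) n = pos n"
proof (induction n rule: less_induct)
  case (less n)
  have inf: "infinite (range pos)"
    using assms strict_mono_imp_inj_on range_inj_infinite by blast
  obtain k where k: "enumerate (range pos) n = pos k"
    using enumerate_in_set[OF inf, of n] by blast
  obtain l where l: "enumerate (range pos) l = pos n"
    using enumerate_Ex[OF inf] by blast
  have "\<not> k < n"
    using less.IH[of k] k inf enumerate_mono[of k n "range pos"] by auto
  moreover have "\<not> l < n"
    using less.IH[of l] l strict_mono_eq[OF assms, of l n] by auto
  ultimately show ?case
    using k l inf assms by (metis antisym_conv2 enumerate_mono_le_iff not_le strict_mono_less)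
qed

text \<open>The return words of \<open>v\<close> are exactly the values of \<open>ret_seq u v\<close>, so any coding of that
  sequence extends to an injective labelling of the return words.\<close>

lemma derived_fixed_by_if_codes_returns:
  assumes "codes_returns u v d" and "fixed_point \<psi> d"
  shows "derived_fixed_by u v \<psi>"
proof -
  obtain pos where mono: "strict_mono pos" and ran: "range pos = occs v u"
    and eq: "\<And>m n. d m = d n \<longleftrightarrow>
        subsequence u (pos m) (pos (Suc m)) = subsequence u (pos n) (pos (Suc n))"
    using assms(1) unfolding codes_returns_def by blast
  \<comment> \<open>The choice of the index is harmless: equal return words have equal
    codes.\<close>
  define \<sigma> where "\<sigma> r = d (SOME n. ret_seq u v n = r)" for r
  have ret: "ret_seq u v n = subsequence u (pos n) (pos (Suc n))" for n
    unfolding ret_seq_def ran[symmetric] strict_mono_eq_enumerate[OF mono] subword_eq_subsequence ..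
  have \<sigma>: "\<sigma> (ret_seq u v n) = d n" for n
  proof -
    have "ret_seq u v (SOME m. ret_seq u v m = ret_seq u v n) = ret_seq u v n"
      by (rule someI) simp
    then show ?thesis unfolding \<sigma>_def using eq ret by simp
  qed
  have "\<exists>n. r = ret_seq u v n" if r: "r \<in> return_words u v" for r
  proof -
    obtain i where i: "i \<in> occs (r @ v) u"
      using r by (auto simp: return_words_def is_factor_def occs_def)
    have nth: "u (i + j) = (r @ v) ! j" if "j < length (r @ v)" for j
      using i that by (simp add: occs_iff_nth)
    \<comment> \<open>In the copy of \<open>r @ v\<close> at position \<open>i\<close>, the word
      \<open>v\<close> occurs only at the two ends, so these are consecutive values of
      \<open>pos\<close>.\<close>
    have occ: "i + j \<in> occs v u \<longleftrightarrow> j \<in> {0, length r}" if "j \<le> length r" for j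
    proof -
      have "j \<in> occs_fin v (r @ v) \<longleftrightarrow> i + j \<in> occs v u"
        using that nth
        by (auto simp: occs_fin_def occs_iff_nth list_eq_iff_nth_eq add.assoc
            simp del: take_append drop_append)
      then show ?thesis using r by (simp add: return_words_def)
    qed
    obtain n where n: "i = pos n" using occ[of 0] ran by auto
    obtain m where m: "i + length r = pos m" using occ[of "length r"] ran by auto
    have "r \<noteq> []" using r by (simp add: return_words_def)
    then have "pos n < pos m" using n m by (simp flip: m)
    then have "n < m" using strict_mono_less[OF mono] by simp
    then have le: "pos (Suc n) \<le> pos m" using mono by (simp add: strict_mono_less_eq)
    have lt: "pos n < pos (Suc n)" using mono by (simp add: strict_mono_less)
    have "i + (pos (Suc n) - i) \<in> occs v u" using lt n ran by auto
    moreover have "pos (Suc n) - i \<le> length r" using le m by simp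
    ultimately have "pos (Suc n) - i \<in> {0, length r}" using occ by blast
    then have "pos (Suc n) = i + length r" using lt n by auto
    then have "ret_seq u v n = subsequence u i (i + length r)" unfolding ret n by simp
    also have "\<dots> = r"
    proof (rule nth_equalityI)
      fix j assume "j < length (subsequence u i (i + length r))"
      then show "subsequence u i (i + length r) ! j = r ! j"
        using nth[of j] by (simp add: nth_append)
    qed simp
    finally show ?thesis by blast
  qed
  note ret_seq_surj = this
  have "inj_on \<sigma> (return_words u v)"
  proof (rule inj_onI)
    fix r r' assume "r \<in> return_words u v" "r' \<in> return_words u v" and eq\<sigma>: "\<sigma> r = \<sigma> r'"
    then obtain m n where mn: "r = ret_seq u v m" "r' = ret_seq u v n"
      using ret_seq_surj by blast
    then have "d m = d n" using eq\<sigma> \<sigma> by simp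
    then show "r = r'" unfolding mn ret eq .
  qed
  then show ?thesis
    unfolding derived_fixed_by_def using assms(2) \<sigma> by auto
qed

text \<open>Base of the descent: the empty word occurs everywhere, so its return words are the
  single letters.\<close>

lemma codes_returns_Nil: "codes_returns u [] u"
  unfolding codes_returns_def
  by (rule exI[of _ "\<lambda>n. n"]) (simp add: strict_mono_def occs_iff_nth set_eq_iff)

text \<open>A prepended letter at which \<open>v\<close> does not start shifts all occurrences by
  one and leaves the return words alone.\<close>

lemma codes_returns_build_iff:
  assumes "0 \<notin> occs v (a ## u)"
  shows "codes_returns (a ## u) v d \<longleftrightarrow> codes_returns u v d"
proof -
  have occs: "occs v (a ## u) = Suc ` occs v u"
    using assms Suc_in_occs_build[of _ v a u]
    by (auto simp: image_iff) (metis not0_implies_Suc)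
  have sub: "subsequence (a ## u) (Suc i) (Suc j) = subsequence u i j" for i j
    by (simp add: list_eq_iff_nth_eq del: subseq_to_Suc)
  show ?thesis
  proof
    assume "codes_returns (a ## u) v d"
    then obtain pos where mono: "strict_mono pos" and ran: "range pos = Suc ` occs v u"
      and eq: "\<And>m n. d m = d n \<longleftrightarrow> subsequence (a ## u) (pos m) (pos (Suc m)) =
        subsequence (a ## u) (pos n) (pos (Suc n))"
      unfolding codes_returns_def occs by blast
    \<comment> \<open>Position 0 is no occurrence, so the truncated subtraction is safe.\<close>
    define pos' where "pos' n = pos n - 1" for n
    have pos: "pos n = Suc (pos' n)" for n
    proof -
      have "pos n \<in> Suc ` occs v u" using ran by blast
      then show ?thesis by (auto simp: pos'_def)
    qed
    have "Suc ` range pos' = Suc ` occs v u"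
      unfolding ran[symmetric] image_image pos[symmetric] ..
    then have "range pos' = occs v u" by (simp add: inj_image_eq_iff)
    moreover have "strict_mono pos'" using mono by (simp add: strict_mono_def pos)
    moreover have "d m = d n \<longleftrightarrow> subsequence u (pos' m) (pos' (Suc m)) =
        subsequence u (pos' n) (pos' (Suc n))" for m n
      unfolding eq pos sub ..
    ultimately show "codes_returns u v d"
      unfolding codes_returns_def by blast
  next
    assume "codes_returns u v d"
    then obtain pos where "strict_mono pos" "range pos = occs v u"
      and "\<And>m n. d m = d n \<longleftrightarrow>
        subsequence u (pos m) (pos (Suc m)) = subsequence u (pos n) (pos (Suc n))"
      unfolding codes_returns_def by blast
    then show "codes_returns (a ## u) v d"
      unfolding codes_returns_def occs
      by (intro exI[of _ "\<lambda>n. Suc (pos n)"]) (auto simp: strict_mono_def sub)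
  qed
qed

text \<open>Each return word of \<open>a # v\<close> begins with \<open>a\<close>; moving this
  \<open>a\<close> to its end gives the return word of \<open>v\<close>. Such a conjugation keeps
  equal words equal and distinct words distinct.\<close>

lemma codes_returns_Cons_shift:
  assumes occs: "occs v u = Suc ` occs (a # v) u" and "codes_returns u (a # v) d"
  shows "codes_returns u v d"
proof -
  obtain pos where mono: "strict_mono pos" and ran: "range pos = occs (a # v) u"
    and eq: "\<And>m n. d m = d n \<longleftrightarrow>
        subsequence u (pos m) (pos (Suc m)) = subsequence u (pos n) (pos (Suc n))"
    using assms(2) unfolding codes_returns_def by blast
  have a: "u (pos n) = a" for n
  proof -
    have "pos n \<in> occs (a # v) u" using ran by blast
    then show ?thesis by (auto simp: occs_iff_nth)
  qed
  have split: "a # subsequence u (Suc (pos n)) (Suc (pos (Suc n))) =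
      subsequence u (pos n) (pos (Suc n)) @ [a]" for n
  proof -
    have "pos n < pos (Suc n)" using mono by (simp add: strict_mono_less)
    then have "subsequence u (pos n) (Suc (pos (Suc n))) =
        u (pos n) # subsequence u (Suc (pos n)) (Suc (pos (Suc n)))"
      by (simp add: subsequence_def upt_conv_Cons del: upt_Suc)
    moreover have "subsequence u (pos n) (Suc (pos (Suc n))) =
        subsequence u (pos n) (pos (Suc n)) @ [u (pos (Suc n))]"
      using \<open>pos n < pos (Suc n)\<close> by simp
    ultimately show ?thesis unfolding a by metis
  qed
  have "d m = d n \<longleftrightarrow> subsequence u (Suc (pos m)) (Suc (pos (Suc m))) =
        subsequence u (Suc (pos n)) (Suc (pos (Suc n)))" for m n
    unfolding eq using split by (metis append1_eq_conv list.inject)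
  moreover have "strict_mono (\<lambda>n. Suc (pos n))" using mono by (simp add: strict_mono_def)
  moreover have "range (\<lambda>n. Suc (pos n)) = occs v u" unfolding occs ran[symmetric] by auto
  ultimately show ?thesis
    unfolding codes_returns_def by (intro exI[of _ "\<lambda>n. Suc (pos n)"]) blast
qed

subsection \<open>Desubstitution\<close>

text \<open>Treats \<open>Gb\<close> (with \<open>e = 0\<close>) and \<open>Gbeta\<close> (with
  \<open>e = 1\<close>) at once. Every block begins with \<open>e\<close>, and \<open>e'\<close>
  only occurs at the end of a long block, so images can be parsed uniquely.\<close>

locale block_morph =
  fixes e e' :: nat and f :: "nat list list"
  assumes e: "e < 2" and e': "e' < 2" and e_neq: "e' \<noteq> e"
    and f: "bin_morph f" and f_e: "f ! e = [e]" and f_e': "f ! e' = [e, e']"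
begin

lemma letter_cases: "a < 2 \<Longrightarrow> a = e \<or> a = e'"
  using e e' e_neq by auto

lemma nth_block: "a < 2 \<Longrightarrow> f ! a = (if a = e then [e] else [e, e'])"
  using letter_cases[of a] e_neq f_e f_e' by auto

lemma apply_inf_0: "binary s \<Longrightarrow> apply_inf f s 0 = e"
  using apply_inf_build[OF f binary_suffix[of s "Suc 0"], of "s 0"] nth_block[of "s 0"]
  by (simp split: if_splits)

text \<open>The trailing \<open>e\<close> shows that the last block of \<open>morph_word f v\<close>
  is complete; without it a final \<open>[e]\<close> could be the beginning of
  \<open>[e, e']\<close>.\<close>

lemma sync:
  assumes "binary s" and "set v \<subseteq> {..<2}" and "apply_inf f s = (morph_word f v @ [e]) \<frown> t"
  shows "\<exists>s'. s = v \<frown> s'"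
  using assms
proof (induction v arbitrary: s)
  case (Cons a v)
  obtain b s' where s: "s = b ## s'" by (metis build_first)
  have b: "b < 2" "binary s'" and a: "a < 2" "set v \<subseteq> {..<2}" using Cons.prems s by auto
  define t' where "t' = (morph_word f v @ [e]) \<frown> t"
  have eq: "f ! b \<frown> apply_inf f s' = f ! a \<frown> t'"
    using Cons.prems(3) apply_inf_build[OF f b(2,1)] unfolding s t'_def
    by (simp only: morph_word_Cons append_assoc conc_conc)
  \<comment> \<open>In both parsings the first block is followed by \<open>e\<close>. If one block
    were \<open>[e]\<close> and the other \<open>[e, e']\<close>, the second letter would be both
    \<open>e\<close> and \<open>e'\<close>.\<close>
  have hd1: "apply_inf f s' 0 = e" by (rule apply_inf_0[OF b(2)])
  have hd2: "t' 0 = e"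
    using nth_block a by (cases v) (auto simp: t'_def)
  have "f ! a = f ! b"
  proof (rule ccontr)
    assume "f ! a \<noteq> f ! b"
    then have "f ! a = [e] \<and> f ! b = [e, e'] \<or> f ! a = [e, e'] \<and> f ! b = [e]"
      using nth_block[OF a(1)] nth_block[OF b(1)] by (auto split: if_splits)
    then show False
      using fun_cong[OF eq, of 1] hd1 hd2 e_neq by auto
  qed
  then have "a = b" using nth_block[OF a(1)] nth_block[OF b(1)] letter_cases a b
    by (auto split: if_splits)
  moreover have "\<exists>s''. s' = v \<frown> s''"
    using eq \<open>a = b\<close> by (intro Cons.IH b a) (simp only: same_concat_eq t'_def)
  ultimately show ?case unfolding s by auto
qed simp

lemma morph_word_inj:
  assumes "set x \<subseteq> {..<2}" "set y \<subseteq> {..<2}" "morph_word f x = morph_word f y"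
  shows "x = y"
  using assms
proof (induction x arbitrary: y)
  case Nil
  then show ?case using bin_morph_nth(1)[OF f] by (cases y) auto
next
  case (Cons a x)
  \<comment> \<open>No image begins with \<open>e'\<close>, so a first block \<open>[e]\<close>
    cannot be confused with \<open>[e, e']\<close>.\<close>
  have no_e': "morph_word f z \<noteq> e' # t" if "set z \<subseteq> {..<2}" for z t
    using that nth_block e_neq by (cases z) (auto split: if_splits)
  obtain b y' where y: "y = b # y'"
    using Cons.prems bin_morph_nth(1)[OF f] by (cases y) auto
  have "a = b"
  proof (rule ccontr)
    assume "a \<noteq> b"
    then have "a = e \<and> b = e' \<or> a = e' \<and> b = e"
      using letter_cases[of a] letter_cases[of b] Cons.prems y by auto
    then show False
    proof (elim disjE conjE)
      assume "a = e" "b = e'"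
      then show False using Cons.prems y no_e'[of x "morph_word f y'"] f_e f_e' by simp
    next
      assume "a = e'" "b = e"
      then show False using Cons.prems y no_e'[of y' "morph_word f x"] f_e f_e' by simp
    qed
  qed
  then show ?case using Cons y by auto
qed

lemma length_morph_word_gt:
  "set v \<subseteq> {..<2} \<Longrightarrow> e' \<in> set v \<Longrightarrow> length v < length (morph_word f v)"
proof (induction v)
  case (Cons a v)
  have "length v \<le> length (morph_word f v)"
    using Cons.prems bin_morph_nth(1)[OF f] by (intro length_morph_word_ge) auto
  then show ?case using Cons nth_block[of a] e_neq by (cases "a = e") auto
qed simp

end

section \<open>Block decomposition of an image word\<close>

locale block_image = block_morph +
  fixes u :: "nat \<Rightarrow> nat"
  assumes u: "binary u"
begin

abbreviation U :: "nat \<Rightarrow> nat" where "U \<equiv> apply_inf f u"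

text \<open>Left ends of the blocks in \<open>U\<close>. As the second letter of a long block is
  \<open>e'\<close>, these are exactly the positions of \<open>e\<close>.\<close>

definition start :: "nat \<Rightarrow> nat" where "start k = length (morph_word f (prefix k u))"

lemma start_0 [simp]: "start 0 = 0"
  by (simp add: start_def)

lemma start_Suc: "start (Suc k) = start k + (if u k = e then 1 else 2)"
  using nth_block[OF binaryD[OF u, of k]] by (simp add: start_def)

lemma suffix_start: "suffix (start k) U = apply_inf f (suffix k u)"
  using apply_inf_prefix_suffix[OF f u, of k] unfolding start_def by (metis suffix_conc_length)

lemma strict_mono_start: "strict_mono start"
  by (simp add: strict_mono_Suc_iff start_Suc)

lemma U_start: "U (start k) = e"
  using fun_cong[OF suffix_start[of k], of 0] apply_inf_0[OF binary_suffix[OF u]] by simp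

lemma U_Suc_start:
  assumes "u k \<noteq> e"
  shows "U (Suc (start k)) = e'"
proof -
  have "suffix (start k) U = apply_inf f (u k ## suffix (Suc k) u)"
    by (simp add: suffix_start)
  also have "\<dots> = [e, e'] \<frown> apply_inf f (suffix (Suc k) u)"
    unfolding apply_inf_build[OF f binary_suffix[OF u] binaryD[OF u]]
    using nth_block[OF binaryD[OF u]] assms by simp
  finally have "suffix (start k) U = [e, e'] \<frown> apply_inf f (suffix (Suc k) u)" .
  from fun_cong[OF this, of 1] show ?thesis by simp
qed

lemma position_cases: "(\<exists>k. i = start k) \<or> (\<exists>k. u k \<noteq> e \<and> i = Suc (start k))"
proof (induction i)
  case 0
  show ?case by (metis start_0)
next
  case (Suc i)
  then show ?case
  proof (elim disjE exE conjE)
    fix k assume "i = start k"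
    then show ?thesis using start_Suc[of k] by (metis Suc_eq_plus1)
  next
    fix k assume "u k \<noteq> e" "i = Suc (start k)"
    then have "Suc i = start (Suc k)" by (simp add: start_Suc)
    then show ?thesis by blast
  qed
qed

lemma U_eq_e_iff: "U i = e \<longleftrightarrow> i \<in> range start"
  using position_cases[of i] U_start U_Suc_start e_neq by auto

lemma U_neq_e:
  assumes "U i \<noteq> e"
  shows "\<exists>k. i = Suc (start k) \<and> Suc i = start (Suc k)"
  using position_cases[of i] U_start U_Suc_start assms by (auto simp: start_Suc)

lemma subsequence_start:
  assumes "k \<le> l"
  shows "subsequence U (start k) (start l) = morph_word f (subsequence u k l)"
proof -
  have "prefix (start l) U = morph_word f (prefix l u)" for l
    using apply_inf_prefix_suffix[OF f u, of l] unfolding start_def by (metis prefix_conc_length)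
  then have "subsequence U (start k) (start l) = drop (start k) (morph_word f (prefix l u))"
    by (metis add_0 subsequence_drop)
  also have "\<dots> = morph_word f (subsequence u k l)"
    unfolding prefix_le_split[OF assms] by (simp add: start_def)
  finally show ?thesis .
qed

text \<open>An occurrence begins with \<open>e\<close>, hence at the start of a block, and
  \<open>sync\<close> recovers \<open>v\<close> from there. Conversely, whatever block follows the
  image of \<open>v\<close> begins with \<open>e\<close>.\<close>

lemma occs_morph_word:
  assumes "set v \<subseteq> {..<2}"
  shows "occs (morph_word f v @ [e]) U = start ` occs v u"
proof (intro equalityI subsetI)
  fix i assume i: "i \<in> occs (morph_word f v @ [e]) U"
  have "U i = (morph_word f v @ [e]) ! 0"
    using i unfolding occs_iff_nth by force
  also have "\<dots> = e" using nth_block assms by (cases v) auto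
  finally obtain k where k: "i = start k" using U_eq_e_iff by auto
  obtain s' where "suffix k u = v \<frown> s'"
    using sync[OF binary_suffix[OF u] assms, of k] i k suffix_start[of k]
    unfolding occs_iff_suffix by metis
  then show "i \<in> start ` occs v u" using k occsI by blast
next
  fix i assume "i \<in> start ` occs v u"
  then obtain k where k: "i = start k" and "k \<in> occs v u" by blast
  then have k_eq: "suffix k u = v \<frown> suffix (k + length v) u"
    by (simp only: occs_iff_suffix)
  define t where "t = apply_inf f (suffix (k + length v) u)"
  have "suffix i U = morph_word f v \<frown> t"
    unfolding k suffix_start t_def
    by (subst k_eq) (intro apply_inf_conc_bin f binary_suffix u assms)
  also have "t = [e] \<frown> suffix 1 t"
    using apply_inf_0[OF binary_suffix[OF u]] build_first[of t] unfolding t_def by simp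
  finally show "i \<in> occs (morph_word f v @ [e]) U"
    by (intro occsI[of _ _ _ "suffix 1 t"]) (simp only: conc_conc)
qed

text \<open>The return words upstairs are the images of those of \<open>v\<close>, and injectivity
  of \<open>f\<close> on words preserves their equality pattern.\<close>

lemma codes_returns_morph_word:
  assumes v: "set v \<subseteq> {..<2}" and "codes_returns u v d"
  shows "codes_returns U (morph_word f v @ [e]) d"
proof -
  obtain pos where mono: "strict_mono pos" and ran: "range pos = occs v u"
    and eq: "\<And>m n. d m = d n \<longleftrightarrow>
        subsequence u (pos m) (pos (Suc m)) = subsequence u (pos n) (pos (Suc n))"
    using assms(2) unfolding codes_returns_def by blast
  have sub: "subsequence U (start (pos n)) (start (pos (Suc n))) =
      morph_word f (subsequence u (pos n) (pos (Suc n)))" for n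
    using mono by (intro subsequence_start) (simp add: strict_mono_less_eq)
  have "d m = d n \<longleftrightarrow> subsequence U (start (pos m)) (start (pos (Suc m))) =
      subsequence U (start (pos n)) (start (pos (Suc n)))" for m n
    unfolding eq sub using morph_word_inj set_subsequence_binary[OF u] by metis
  moreover have "strict_mono (\<lambda>n. start (pos n))"
    using mono strict_mono_start by (simp add: strict_mono_def)
  moreover have "range (\<lambda>n. start (pos n)) = occs (morph_word f v @ [e]) U"
    unfolding occs_morph_word[OF v] ran[symmetric] by auto
  ultimately show ?thesis
    unfolding codes_returns_def by (intro exI[of _ "\<lambda>n. start (pos n)"]) blast
qed

text \<open>The letter \<open>e'\<close> ends a block and the next block begins with
  \<open>e\<close>, so appending \<open>e\<close> loses no occurrence.\<close>

lemma occs_snoc: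
  assumes "v \<noteq> []" "last v \<noteq> e"
  shows "occs (v @ [e]) U = occs v U"
proof -
  have "U (i + length v) = e" if "i \<in> occs v U" for i
  proof -
    have "U (i + (length v - 1)) \<noteq> e"
      using that assms by (simp add: occs_iff_nth last_conv_nth)
    from U_neq_e[OF this] obtain k where "Suc (i + (length v - 1)) = start k" by blast
    moreover have "Suc (i + (length v - 1)) = i + length v" using assms(1) by (cases v) auto
    ultimately show ?thesis using U_start by metis
  qed
  then show ?thesis by (auto simp: occs_iff_nth nth_append less_Suc_eq)
qed

text \<open>The letter \<open>e'\<close> is always the second one of a block, hence preceded by
  \<open>e\<close>.\<close>

lemma occs_Cons:
  assumes "v \<noteq> []" "hd v \<noteq> e"
  shows "occs v U = Suc ` occs (e # v) U"
proof (intro equalityI subsetI)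
  fix i assume i: "i \<in> occs v U"
  have "U (i + 0) = v ! 0" using i assms(1) unfolding occs_iff_nth by blast
  then have "U i \<noteq> e" using assms by (simp add: hd_conv_nth)
  from U_neq_e[OF this] obtain k where "i = Suc (start k)" by blast
  moreover have "start k \<in> occs (e # v) U"
    using i calculation U_start by (auto simp: occs_iff_nth nth_Cons split: nat.split)
  ultimately show "i \<in> Suc ` occs (e # v) U" by blast
qed (force simp: occs_iff_nth)

text \<open>A factor beginning with the leading letter is desubstituted after completing its last
  block; the length decreases because either the appended letter or a long block is lost.\<close>

lemma desubstitute_leading:
  assumes "is_factor v U" "v \<noteq> []" "hd v = e"
  obtains v' where "is_factor v' u" "set v' \<subseteq> {..<2}"
    "v = morph_word f v' @ [e] \<or> v = morph_word f v' \<and> last v \<noteq> e"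
    "length v' < length v"
    "\<And>d. codes_returns u v' d \<Longrightarrow> codes_returns U v d"
proof -
  obtain i where i: "i \<in> occs v U" using assms(1) is_factor_iff_occs by blast
  have v: "v = subsequence U i (i + length v)"
    using i by (simp add: occs_def subword_eq_subsequence)
  have "U (i + 0) = v ! 0" using i assms(2) unfolding occs_iff_nth by blast
  then have "U i = e" using assms by (simp add: hd_conv_nth)
  then obtain k where k: "i = start k" using U_eq_e_iff by auto
  define j where "j = i + (length v - 1)"
  have j: "i + length v = Suc j" using assms(2) by (simp add: j_def)
  have last: "U j = last v" using i assms(2) by (simp add: occs_iff_nth j_def last_conv_nth)
  have factor: "is_factor (subsequence u k l) u" for l
    by (cases "k \<le> l")
      (auto simp: is_factor_def subword_eq_subsequence intro: exI[of _ k])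
  have bin: "set (subsequence u k l) \<subseteq> {..<2}" for l by (rule set_subsequence_binary[OF u])
  show ?thesis
  proof (cases "last v = e")
    case True
    \<comment> \<open>The last letter of \<open>v\<close>, at position \<open>j\<close>, opens block
      \<open>l\<close>: so \<open>v\<close> consists of the blocks \<open>k\<close> to
      \<open>l - 1\<close> and one more \<open>e\<close>.\<close>
    then obtain l where l: "j = start l" using last U_eq_e_iff by auto
    have "k \<le> l" using k l j_def strict_mono_less_eq[OF strict_mono_start, of k l] by simp
    have "v = subsequence U (start k) (start l) @ [U j]"
      using v unfolding j using k l by (simp add: j_def)
    then have eq: "v = morph_word f (subsequence u k l) @ [e]"
      unfolding subsequence_start[OF \<open>k \<le> l\<close>] using last True by simp
    have "length (subsequence u k l) \<le> length (morph_word f (subsequence u k l))"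
      using bin[of l] bin_morph_nth(1)[OF f] by (intro length_morph_word_ge) auto
    then have "length (subsequence u k l) < length v"
      using arg_cong[OF eq, of length] by simp
    moreover have "codes_returns U v d" if "codes_returns u (subsequence u k l) d" for d
      unfolding eq by (rule codes_returns_morph_word[OF bin that])
    ultimately show ?thesis using that[OF factor bin] eq by blast
  next
    case False
    \<comment> \<open>The last letter closes a block, so \<open>v\<close> is a full image.\<close>
    then obtain l where l: "Suc j = start l" using last U_neq_e[of j] by metis
    have "k \<le> l" using k l j_def strict_mono_less_eq[OF strict_mono_start, of k l] by simp
    have eq: "v = morph_word f (subsequence u k l)"
      using v unfolding j l unfolding k subsequence_start[OF \<open>k \<le> l\<close>] .
    \<comment> \<open>The image of a power of \<open>e\<close> ends in \<open>e\<close>; so a long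
      block occurs, and the preimage is strictly shorter.\<close>
    have "e' \<in> set (subsequence u k l)"
    proof (rule ccontr)
      assume "e' \<notin> set (subsequence u k l)"
      then have "set (subsequence u k l) \<subseteq> {e}" using bin[of l] letter_cases by blast
      then have "set (morph_word f (subsequence u k l)) \<subseteq> {e}"
        using f_e unfolding morph_word_def by auto
      moreover have "last v \<in> set v" using assms(2) by simp
      ultimately show False using False eq by auto
    qed
    then have "length (subsequence u k l) < length v"
      using length_morph_word_gt[OF bin] eq by metis
    moreover have "codes_returns U v d" if "codes_returns u (subsequence u k l) d" for d
    proof -
      have "codes_returns U (v @ [e]) d"
        using codes_returns_morph_word[OF bin that] unfolding eq[symmetric] .
      then show ?thesis unfolding codes_returns_def occs_snoc[OF assms(2) False] .
    qed
    ultimately show ?thesis using that[OF factor bin] eq False by blast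
  qed
qed

text \<open>Completing the first block to \<open>e # v\<close> costs one letter, which may cancel
  the gain in length. This happens only when \<open>e # v\<close> is the single block
  \<open>[e, e']\<close>.\<close>

lemma desubstitute_other:
  assumes "is_factor v U" "v \<noteq> []" "hd v \<noteq> e"
  obtains v' where "is_factor v' u"
    "length v' < length v \<or> v = [e'] \<and> v' = [e']"
    "\<And>d. codes_returns u v' d \<Longrightarrow> codes_returns U v d"
proof -
  note occs = occs_Cons[OF assms(2,3)]
  have "is_factor (e # v) U" using assms(1) occs unfolding is_factor_iff_occs by auto
  then obtain v' where v': "is_factor v' u" "set v' \<subseteq> {..<2}"
      "e # v = morph_word f v' @ [e] \<or> e # v = morph_word f v' \<and> last (e # v) \<noteq> e"
      "length v' < length (e # v)"
      "\<And>d. codes_returns u v' d \<Longrightarrow> codes_returns U (e # v) d"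
    by (rule desubstitute_leading) auto
  have codes: "codes_returns U v d" if "codes_returns u v' d" for d
    by (rule codes_returns_Cons_shift[OF occs v'(5)[OF that]])
  have "length v' < length v \<or> v = [e'] \<and> v' = [e']"
  proof -
    obtain b v'' where b: "v' = b # v''" "b < 2" "set v'' \<subseteq> {..<2}"
      using v'(2,3) assms(2) by (cases v') auto
    \<comment> \<open>As \<open>e # v\<close> begins with \<open>e\<close> and \<open>e'\<close>,
      its first block is the long one, so \<open>v'\<close> cannot begin with
      \<open>e\<close>.\<close>
    have v: "v = e' # morph_word f v'' @ [e] \<and> b \<noteq> e
        \<or> v = e' # morph_word f v'' \<and> b \<noteq> e \<and> last v \<noteq> e"
    proof (cases "b = e")
      case True
      have "hd (morph_word f v'' @ [e]) = e" "v'' \<noteq> [] \<Longrightarrow> hd (morph_word f v'') = e"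
        using b(3) nth_block by (cases v''; simp)+
      then show ?thesis using v'(3) b True nth_block[OF b(2)] assms(2,3)
        by (cases "v'' = []") auto
    next
      case False
      then show ?thesis using v'(3) b nth_block[OF b(2)] assms(2) by auto
    qed
    have le: "length v'' \<le> length (morph_word f v'')"
      using b(3) bin_morph_nth(1)[OF f] by (intro length_morph_word_ge) auto
    show ?thesis
    proof (cases "v = e' # morph_word f v'' @ [e]")
      case True
      then show ?thesis using le b by simp
    next
      case False
      then have v: "v = e' # morph_word f v''" "b = e'" "last v \<noteq> e"
        using v letter_cases[OF b(2)] by auto
      show ?thesis
      proof (cases "v'' = []")
        case True
        then show ?thesis using v b by simp
      next
        case nonempty: False
        have "e' \<in> set v''"
        proof (rule ccontr)
          assume "e' \<notin> set v''"
          then have *: "set v'' \<subseteq> {e}" using b(3) letter_cases by blast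
          then have "set (morph_word f v'') \<subseteq> {e}" using f_e unfolding morph_word_def by auto
          moreover have "morph_word f v'' \<noteq> []" using nonempty le by auto
          moreover have "last (morph_word f v'') \<noteq> e" using v calculation(2) by simp
          ultimately show False using last_in_set[of "morph_word f v''"] by blast
        qed
        then show ?thesis using length_morph_word_gt[OF b(3)] v(1) b(1) by simp
      qed
    qed
  qed
  then show ?thesis using that[OF v'(1) _ codes] by blast
qed

end

subsection \<open>Extensions of characteristic words\<close>

text \<open>The letter fixed by the generator; for \<open>Gb\<close> and \<open>Gbeta\<close> it is
  also the first letter of both images.\<close>

fun lead :: "gen \<Rightarrow> nat" where
  "lead Ga = 0"
| "lead Gb = 0"
| "lead Galpha = 1"
| "lead Gbeta = 1"

lemma block_morph_gen:
  assumes "x \<in> {Gb, Gbeta}"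
  shows "block_morph (lead x) (1 - lead x) (gen_morph x)"
proof -
  have "gen_morph x ! lead x = [lead x]" "gen_morph x ! (1 - lead x) = [lead x, 1 - lead x]"
    "lead x < 2" "1 - lead x < 2" "1 - lead x \<noteq> lead x"
    using assms by auto
  then show ?thesis unfolding block_morph_def using bin_morph_gen by blast
qed

definition extensions :: "nat list set" where
  "extensions = {[], [0], [1], [0, 1], [1, 0]}"

text \<open>For all four pairs of generators \<open>w\<close> is kept over \<open>Gb\<close>,
  \<open>Gbeta\<close>, and \<open>y\<close> records the pair; \<open>[0, 1]\<close> and
  \<open>[1, 0]\<close> both stand for \<open>Ga\<close>, \<open>Galpha\<close>.\<close>

definition extended_fixed :: "gen list \<Rightarrow> (nat \<Rightarrow> nat) \<Rightarrow> bool" where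
  "extended_fixed w u \<longleftrightarrow> set w = {Gb, Gbeta} \<and>
     (\<exists>y\<in>extensions. \<exists>c. binary c \<and> apply_inf (phi w) c = c \<and> u = y \<frown> c)"

lemma binary_extended_fixed: "extended_fixed w u \<Longrightarrow> binary u"
proof -
  assume "extended_fixed w u"
  then obtain y c where "y \<in> extensions" "binary c" "u = y \<frown> c"
    unfolding extended_fixed_def by blast
  then show ?thesis by (auto simp: extensions_def)
qed

text \<open>If \<open>c\<close> is fixed by a composition of \<open>g\<close> after
  \<open>h\<close>, then the image of \<open>c\<close> under \<open>h\<close> is fixed by
  \<open>h\<close> after \<open>g\<close>.\<close>

lemma fixed_rotate:
  assumes "binary c" "apply_inf (phi (x # w)) c = c"
  defines "c' \<equiv> apply_inf (phi w) c"
  shows "binary c'" "apply_inf (gen_morph x) c' = c" "apply_inf (phi (w @ [x])) c' = c'"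
proof -
  show c': "binary c'" using assms(1) by (simp add: c'_def)
  show c: "apply_inf (gen_morph x) c' = c"
    using assms by (simp add: apply_inf_phi_Cons del: phi.simps)
  have "apply_inf (phi [x]) c' = c"
    using c c' by (simp add: apply_inf_phi_Cons apply_inf_phi_Nil del: phi.simps)
  then show "apply_inf (phi (w @ [x])) c' = c'"
    unfolding apply_inf_phi_append[OF c'] by (simp add: c'_def)
qed

section \<open>The descent along the first letter of \<open>w\<close>\<close>

lemma (in block_image) desubstitute:
  assumes "is_factor v U" "v \<noteq> []"
  obtains v' where "is_factor v' u"
    "length v' < length v \<or> v = [e'] \<and> v' = [e']"
    "\<And>d. codes_returns u v' d \<Longrightarrow> codes_returns U v d"
proof (cases "hd v = e")
  case True
  show ?thesis by (rule desubstitute_leading[OF assms True]) (use that in blast)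
next
  case False
  show ?thesis by (rule desubstitute_other[OF assms False]) (use that in blast)
qed

lemma extended_fixed_desubstitute:
  assumes ext: "extended_fixed (x # w) u" and v: "is_factor v u" "v \<noteq> []"
  obtains u' v' where "extended_fixed (w @ [x]) u'" "is_factor v' u'"
    "length v' < length v \<or> v = [1 - lead x] \<and> v' = [1 - lead x]"
    "\<And>d. codes_returns u' v' d \<Longrightarrow> codes_returns u v d"
proof -
  define e e' f where "e = lead x" and "e' = 1 - lead x" and "f = gen_morph x"
  have x: "x \<in> {Gb, Gbeta}" and set_w: "set (w @ [x]) = {Gb, Gbeta}"
    using ext by (auto simp: extended_fixed_def)
  interpret block_morph e e' f
    unfolding e_def e'_def f_def by (rule block_morph_gen[OF x])
  obtain y c where y: "y \<in> extensions" and c: "binary c" "apply_inf (phi (x # w)) c = c"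
    and u_eq: "u = y \<frown> c"
    using ext unfolding extended_fixed_def by blast
  define c' where "c' = apply_inf (phi w) c"
  have c': "binary c'" "apply_inf f c' = c" "apply_inf (phi (w @ [x])) c' = c'"
    using fixed_rotate[OF c] by (simp_all add: c'_def f_def)
  have ext': "extended_fixed (w @ [x]) (z \<frown> c')" if "z \<in> extensions" for z
    using that c' set_w unfolding extended_fixed_def by blast
  have extensions: "extensions = {[], [e], [e'], [e, e'], [e', e]}"
    using x by (auto simp: extensions_def e_def e'_def)
  have bin: "binary (z \<frown> c')" if "z \<in> extensions" for z
    using that c'(1) by (auto simp: extensions_def)
  have image: "apply_inf f (z \<frown> c') = morph_word f z \<frown> c" if "z \<in> extensions" for z
    using apply_inf_conc_bin[OF f c'(1), of z] c'(2) that e e' by (auto simp: extensions)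
  have image_block: "block_image e e' f (z \<frown> c')" if "z \<in> extensions" for z
    by unfold_locales (rule bin[OF that])
  \<comment> \<open>The image of \<open>y \<frown> c'\<close> is
    \<open>morph_word f y \<frown> c\<close>. This is \<open>u\<close> if \<open>y\<close> is
    \<open>[]\<close> or \<open>[e]\<close>, and \<open>u\<close> with an extra \<open>e\<close> in
    front for the other three extensions.\<close>
  consider "y \<in> {[], [e]}" | b y' where "y = b # y'" "b \<in> {e, e'}" "y' \<in> extensions"
      "apply_inf f (y \<frown> c') = e ## u"
  proof -
    assume 1: "y \<in> {[], [e]} \<Longrightarrow> thesis"
    assume 2: "\<And>b y'. y = b # y' \<Longrightarrow> b \<in> {e, e'} \<Longrightarrow> y' \<in> extensions \<Longrightarrow>
        apply_inf f (y \<frown> c') = e ## u \<Longrightarrow> thesis"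
    show thesis
    proof (cases "y \<in> {[], [e]}")
      case False
      then have "y \<in> {[e'], [e, e'], [e', e]}" using y unfolding extensions by blast
      moreover from this have "apply_inf f (y \<frown> c') = e ## u"
        using image[OF y] f_e f_e' u_eq by auto
      ultimately show thesis using 2[of "hd y" "tl y"] by (auto simp: extensions)
    qed (use 1 in blast)
  qed
  then show ?thesis
  proof cases
    case 1
    interpret img: block_image e e' f "y \<frown> c'" by (rule image_block[OF y])
    have "apply_inf f (y \<frown> c') = u" using image[OF y] 1 f_e u_eq by auto
    with img.desubstitute[of v] v obtain v' where "is_factor v' (y \<frown> c')"
        "length v' < length v \<or> v = [e'] \<and> v' = [e']"
        "\<And>d. codes_returns (y \<frown> c') v' d \<Longrightarrow> codes_returns u v d" by auto
    then show ?thesis using that[OF ext'[OF y]] unfolding e'_def by blast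
  next
    case (2 b y')
    show ?thesis
    proof (cases "hd v = e")
      case True
      \<comment> \<open>The extra \<open>e\<close> could start a spurious occurrence of
        \<open>v\<close>, so the first letter of \<open>y\<close> is dropped: \<open>u\<close> is
        the image of \<open>y' \<frown> c'\<close>, possibly after a leading \<open>e'\<close>,
        where \<open>v\<close> cannot start.\<close>
      interpret img: block_image e e' f "y' \<frown> c'" by (rule image_block[OF 2(3)])
      have "e ## u = f ! b \<frown> img.U"
        using 2(2) e e' unfolding 2(4)[symmetric] 2(1)
        by (auto simp: apply_inf_build[OF f bin[OF 2(3)]])
      then have uU: "u = img.U \<or> u = e' ## img.U" using 2(2) f_e f_e' by auto
      have not0: "0 \<notin> occs v (e' ## img.U)"
        using True v(2) e_neq by (auto simp: occs_iff_nth hd_conv_nth intro!: exI[of _ 0])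
      have "occs v (e' ## img.U) \<subseteq> Suc ` occs v img.U"
        using not0 Suc_in_occs_build[of _ v e' img.U] by (metis image_eqI not0_implies_Suc subsetI)
      then have "is_factor v img.U" using v(1) uU unfolding is_factor_iff_occs by auto
      then obtain v' where v': "is_factor v' (y' \<frown> c')" "length v' < length v"
          "\<And>d. codes_returns (y' \<frown> c') v' d \<Longrightarrow> codes_returns img.U v d"
        by (rule img.desubstitute_leading[OF _ v(2) True]) blast
      have "codes_returns u v d" if "codes_returns (y' \<frown> c') v' d" for d
        using v'(3)[OF that] uU codes_returns_build_iff[OF not0] by auto
      then show ?thesis using that[OF ext'[OF 2(3)] v'(1)] v'(2) by blast
    next
      case False
      \<comment> \<open>Now \<open>v\<close> does not begin with \<open>e\<close>, so the extra
        \<open>e\<close> in front creates no occurrence.\<close>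
      interpret img: block_image e e' f "y \<frown> c'" by (rule image_block[OF y])
      have U: "img.U = e ## u" by (rule 2(4))
      have not0: "0 \<notin> occs v (e ## u)"
        using False v(2) by (auto simp: occs_iff_nth hd_conv_nth intro!: exI[of _ 0])
      have "is_factor v img.U"
        using v(1) Suc_in_occs_build[of _ v e u] unfolding U is_factor_iff_occs by auto
      then obtain v' where v': "is_factor v' (y \<frown> c')"
          "length v' < length v \<or> v = [e'] \<and> v' = [e']"
          "\<And>d. codes_returns (y \<frown> c') v' d \<Longrightarrow> codes_returns img.U v d"
        by (rule img.desubstitute[OF _ v(2)]) blast
      have "codes_returns u v d" if "codes_returns (y \<frown> c') v' d" for d
        using v'(3)[OF that] codes_returns_build_iff[OF not0] unfolding U by simp
      then show ?thesis using that[OF ext'[OF y] v'(1)] v'(2) unfolding e'_def by blast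
    qed
  qed
qed

text \<open>In the one case without gain in length, \<open>v\<close> is the letter
  \<open>1 - lead x\<close>. The second component of the measure counts the letters of
  \<open>w\<close> before the first one that leads with this letter, and the rotation lowers
  it.\<close>

lemma extended_fixed_derived:
  assumes "extended_fixed w u" "is_factor v u"
  shows "\<exists>w' d. length w' = length w \<and> extended_fixed w' d \<and> codes_returns u v d"
  using assms
proof (induction "(length v, length (takeWhile (\<lambda>x. lead x \<noteq> hd v) w))" arbitrary: v w u
    rule: wf_induct_rule[OF wf_lex_prod[OF wf_less_than wf_less_than]])
  case (1 v w u)
  show ?case
  proof (cases "v = []")
    case True
    then show ?thesis using 1 codes_returns_Nil by blast
  next
    case False
    have "set w = {Gb, Gbeta}" using 1(2) by (simp add: extended_fixed_def)
    then obtain x z where w: "w = x # z" by (cases w) auto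
    obtain u' v' where u': "extended_fixed (z @ [x]) u'" "is_factor v' u'"
        "length v' < length v \<or> v = [1 - lead x] \<and> v' = [1 - lead x]"
        "\<And>d. codes_returns u' v' d \<Longrightarrow> codes_returns u v d"
      using extended_fixed_desubstitute[OF 1(2)[unfolded w] 1(3) False] by metis
    \<comment> \<open>Both generators occur in \<open>w\<close>, so the search succeeds within
      \<open>z\<close>: the failing \<open>x\<close> in front is gone, and the \<open>x\<close> put
      at the end is never reached.\<close>
    have "length (takeWhile (\<lambda>y. lead y \<noteq> 1 - lead x) (z @ [x])) <
        length (takeWhile (\<lambda>y. lead y \<noteq> 1 - lead x) w)"
    proof -
      have "\<exists>y\<in>set w. lead y = 1 - lead x" using \<open>set w = {Gb, Gbeta}\<close> w by (cases x) auto
      moreover have "lead x \<noteq> 1 - lead x" by (cases x) auto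
      ultimately obtain y where "y \<in> set z" "\<not> lead y \<noteq> 1 - lead x" using w by auto
      from takeWhile_append1[of y z "\<lambda>y. lead y \<noteq> 1 - lead x", OF this]
      show ?thesis using \<open>lead x \<noteq> 1 - lead x\<close> by (simp add: w)
    qed
    then have "((length v', length (takeWhile (\<lambda>x. lead x \<noteq> hd v') (z @ [x]))),
        (length v, length (takeWhile (\<lambda>x. lead x \<noteq> hd v) w))) \<in> less_than <*lex*> less_than"
      using u'(3) by auto
    from 1(1)[OF this u'(1,2)] show ?thesis using u'(4) w by auto
  qed
qed

subsection \<open>Conjugate morphisms\<close>

text \<open>Moving \<open>e\<close> through the image letter by letter gives the finite identity
  \<open>fin\<close>; for an infinite word the \<open>e\<close> at the right end disappears.\<close>

lemma apply_inf_conjugate: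
  assumes f: "bin_morph f" and g: "bin_morph g" and c: "binary c"
    and conj: "\<And>a. a < 2 \<Longrightarrow> f ! a @ [e] = e # g ! a"
  shows "apply_inf f c = e ## apply_inf g c"
proof
  fix i
  let ?p = "prefix (Suc i) c"
  have fin: "morph_word f w @ [e] = e # morph_word g w" if "set w \<subseteq> {..<2}" for w
    using that by (induction w) (use conj in \<open>force+\<close>)
  have p: "set ?p \<subseteq> {..<2}" by (rule set_subsequence_binary[OF c])
  have lf: "Suc i \<le> length (morph_word f ?p)" and lg: "Suc i \<le> length (morph_word g ?p)"
    by (intro length_morph_word_prefix_ge f g c)+
  have "apply_inf f c i = (morph_word f ?p @ [e]) ! i"
    using lf by (simp add: apply_inf_nth[OF f c] nth_append del: subseq_to_Suc)
  also have "\<dots> = (e # morph_word g ?p) ! i" unfolding fin[OF p] ..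
  also have "\<dots> = (e ## apply_inf g c) i"
  proof (cases i)
    case (Suc j)
    have "apply_inf g c j = morph_word g ?p ! j"
      using apply_inf_prefix_suffix[OF g c, of "Suc i"] lg Suc
      by (metis Suc_le_lessD Suc_lessD conc_fst)
    then show ?thesis using Suc by simp
  qed simp
  finally show "apply_inf f c i = (e ## apply_inf g c) i" .
qed

lemma apply_inf_Gb: "binary c \<Longrightarrow> apply_inf (gen_morph Gb) c = 0 ## apply_inf (gen_morph Ga) c"
  by (rule apply_inf_conjugate[OF bin_morph_gen bin_morph_gen]) (auto simp: less_2_cases_iff)

lemma apply_inf_Gbeta:
  "binary c \<Longrightarrow> apply_inf (gen_morph Gbeta) c = 1 ## apply_inf (gen_morph Galpha) c"
  by (rule apply_inf_conjugate[OF bin_morph_gen bin_morph_gen]) (auto simp: less_2_cases_iff)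

text \<open>Chosen so that \<open>y\<close> survives: \<open>Ga\<close> sends \<open>1 ## c\<close>
  to \<open>1\<close> followed by the \<open>Gb\<close>-image of \<open>c\<close>, because
  \<open>Gb\<close> puts a \<open>0\<close> before the \<open>Ga\<close>-image. The letter
  \<open>0\<close> and \<open>Galpha\<close> behave symmetrically.\<close>

fun conjugate :: "nat list \<Rightarrow> gen \<Rightarrow> gen" where
  "conjugate y Gb = (if 1 \<in> set y then Ga else Gb)"
| "conjugate y Gbeta = (if 0 \<in> set y then Galpha else Gbeta)"
| "conjugate y x = x"

lemma apply_inf_gen_build:
  "binary s \<Longrightarrow> a < 2 \<Longrightarrow> apply_inf (gen_morph x) (a ## s) = gen_morph x ! a \<frown> apply_inf (gen_morph x) s"
  by (rule apply_inf_build[OF bin_morph_gen])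

lemma apply_inf_conjugate_gen:
  assumes "x \<in> {Gb, Gbeta}" "y \<in> extensions" "binary c"
  shows "apply_inf (gen_morph (conjugate y x)) (y \<frown> c) = y \<frown> apply_inf (gen_morph x) c"
proof -
  have nth: "gen_morph Ga ! 0 = [0]" "gen_morph Ga ! Suc 0 = [Suc 0, 0]"
    "gen_morph Gb ! 0 = [0]" "gen_morph Gb ! Suc 0 = [0, Suc 0]"
    "gen_morph Galpha ! 0 = [0, Suc 0]" "gen_morph Galpha ! Suc 0 = [Suc 0]"
    "gen_morph Gbeta ! 0 = [Suc 0, 0]" "gen_morph Gbeta ! Suc 0 = [Suc 0]"
    by simp_all
  show ?thesis
    using assms(1,2) unfolding extensions_def insert_iff empty_iff
    by (elim disjE FalseE; hypsubst)
      (simp_all add: apply_inf_gen_build apply_inf_Gb apply_inf_Gbeta nth assms(3) del: gen_morph.simps)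
qed

text \<open>Transfers fixed points in both directions: prepend \<open>y\<close>, or cancel
  it.\<close>

lemma apply_inf_phi_conjugate:
  assumes "set w \<subseteq> {Gb, Gbeta}" "y \<in> extensions" "binary c"
  shows "apply_inf (phi (map (conjugate y) w)) (y \<frown> c) = y \<frown> apply_inf (phi w) c"
proof -
  have bin: "binary (y \<frown> s)" if "binary s" for s
    using that assms(2) by (auto simp: extensions_def)
  show ?thesis
    using assms(1)
  proof (induction w)
    case Nil
    then show ?case using apply_inf_phi_Nil[OF assms(3)] apply_inf_phi_Nil[OF bin[OF assms(3)]] by simp
  next
    case (Cons x w)
    then show ?case
      using apply_inf_conjugate_gen[OF _ assms(2) binary_phi[OF assms(3)], of x w] assms(3)
      by (simp add: apply_inf_phi_Cons bin del: phi.simps binary_conc)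
  qed
qed

text \<open>The fixed length makes the set finite; the presence of both generators of a pair gives
  primitivity.\<close>

definition index_words :: "nat \<Rightarrow> gen list set" where
  "index_words m = {w. length w = m \<and>
     set w \<in> {{Gb, Gbeta}, {Gb, Galpha}, {Ga, Gbeta}, {Ga, Galpha}}}"

lemma fixed_point_phi_iff: "fixed_point (phi w) u \<longleftrightarrow> binary u \<and> apply_inf (phi w) u = u"
  using bin_morph_phi[of w] by (simp add: fixed_point_def binary_def bin_morph_def)

lemma fixed_point_if_extended_fixed:
  assumes "extended_fixed w u"
  shows "\<exists>w'\<in>index_words (length w). fixed_point (phi w') u"
proof -
  obtain y c where y: "y \<in> extensions" and c: "binary c" "apply_inf (phi w) c = c" "u = y \<frown> c"
    and w: "set w = {Gb, Gbeta}"
    using assms unfolding extended_fixed_def by blast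
  have "fixed_point (phi (map (conjugate y) w)) u"
    using apply_inf_phi_conjugate[of w y c] y c w binary_extended_fixed[OF assms]
    by (simp add: fixed_point_phi_iff)
  moreover have "map (conjugate y) w \<in> index_words (length w)"
    using w by (auto simp: index_words_def)
  ultimately show ?thesis by blast
qed

fun standard :: "gen \<Rightarrow> gen" where
  "standard Ga = Gb"
| "standard Galpha = Gbeta"
| "standard x = x"

lemma extended_fixed_standard:
  assumes u: "fixed_point (phi w) u" "u = y \<frown> c" and y: "y \<in> extensions"
    and w: "set w = {conjugate y Gb, conjugate y Gbeta}"
  shows "extended_fixed (map standard w) u"
proof -
  have set: "set (map standard w) = {Gb, Gbeta}" using w by auto
  have "map (conjugate y) (map standard w) = map id w"
    unfolding map_map by (rule map_cong) (use w in auto)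
  moreover have c: "binary c" using u by (simp add: fixed_point_phi_iff)
  ultimately have "y \<frown> apply_inf (phi (map standard w)) c = y \<frown> c"
    using apply_inf_phi_conjugate[of "map standard w" y c] y set u
    by (simp add: fixed_point_phi_iff)
  then have "apply_inf (phi (map standard w)) c = c" by simp
  then show ?thesis using set y c u unfolding extended_fixed_def by blast
qed

section \<open>First letters of fixed points\<close>

lemma apply_inf_gen_0:
  assumes "binary s"
  shows "apply_inf (gen_morph x) s 0 = gen_morph x ! s 0 ! 0"
proof -
  have "apply_inf (gen_morph x) s = gen_morph x ! s 0 \<frown> apply_inf (gen_morph x) (suffix 1 s)"
    using apply_inf_gen_build[OF binary_suffix[OF assms] binaryD[OF assms], of x 0 "Suc 0"] by simp
  then show ?thesis
    using bin_morph_nth(1)[OF bin_morph_gen binaryD[OF assms], of x 0] by simp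
qed

text \<open>An image under \<open>Gb\<close> begins with \<open>0\<close>, and \<open>Galpha\<close>
  keeps this first letter; \<open>Gbeta\<close> and \<open>Ga\<close> behave symmetrically.\<close>

lemma apply_inf_phi_0:
  assumes "binary s"
  shows "set w \<subseteq> {Gb, Galpha} \<Longrightarrow> Gb \<in> set w \<Longrightarrow> apply_inf (phi w) s 0 = 0"
    and "set w \<subseteq> {Ga, Gbeta} \<Longrightarrow> Gbeta \<in> set w \<Longrightarrow> apply_inf (phi w) s 0 = 1"
proof -
  have *: "apply_inf (phi w) s 0 = 0 \<or> apply_inf (phi w) s 0 = 1" for w
    using binaryD[OF binary_phi[OF assms], of w 0] by linarith
  show "set w \<subseteq> {Gb, Galpha} \<Longrightarrow> Gb \<in> set w \<Longrightarrow> apply_inf (phi w) s 0 = 0"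
  proof (induction w)
    case (Cons x w)
    then show ?case
      using *[of w] by (auto simp: apply_inf_phi_Cons apply_inf_gen_0 assms simp del: phi.simps)
  qed simp
  show "set w \<subseteq> {Ga, Gbeta} \<Longrightarrow> Gbeta \<in> set w \<Longrightarrow> apply_inf (phi w) s 0 = 1"
  proof (induction w)
    case (Cons x w)
    then show ?case
      using *[of w] by (auto simp: apply_inf_phi_Cons apply_inf_gen_0 assms simp del: phi.simps)
  qed simp
qed

text \<open>Both generators keep the first letter. After a first letter \<open>0\<close>,
  \<open>Galpha\<close> makes the second letter \<open>1\<close>, and \<open>Ga\<close> keeps a
  \<open>1\<close> there; the other case is symmetric.\<close>

lemma apply_inf_phi_01:
  assumes "binary s" "set w \<subseteq> {Ga, Galpha}"
  shows "s 0 = 0 \<Longrightarrow> apply_inf (phi w) s 0 = 0 \<and> (Galpha \<in> set w \<longrightarrow> apply_inf (phi w) s 1 = 1)"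
    and "s 0 = 1 \<Longrightarrow> apply_inf (phi w) s 0 = 1 \<and> (Ga \<in> set w \<longrightarrow> apply_inf (phi w) s 1 = 0)"
proof -
  have keep: "apply_inf (gen_morph x) t 0 = t 0" if "x \<in> {Ga, Galpha}" "binary t" for x t
    using that(1) binaryD[OF that(2), of 0] by (auto simp: apply_inf_gen_0[OF that(2)] less_2_cases_iff)
  have split: "apply_inf (gen_morph x) t = gen_morph x ! t 0 \<frown> apply_inf (gen_morph x) (suffix 1 t)"
    if "binary t" for x t
    using apply_inf_gen_build[OF binary_suffix[OF that] binaryD[OF that], of x 0 "Suc 0"] by simp
  have bin: "binary (apply_inf (phi w) s)" for w using assms(1) by simp
  show "s 0 = 0 \<Longrightarrow> apply_inf (phi w) s 0 = 0 \<and> (Galpha \<in> set w \<longrightarrow> apply_inf (phi w) s 1 = 1)"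
    using assms(2)
  proof (induction w)
    case Nil
    then show ?case using apply_inf_phi_Nil[OF assms(1)] by simp
  next
    case (Cons x w)
    then show ?case
      using split[OF bin, of x w] keep[of x "apply_inf (phi w) s"]
        keep[of x "suffix 1 (apply_inf (phi w) s)"] bin[of w]
      by (auto simp: apply_inf_phi_Cons[OF assms(1)] simp del: phi.simps)
  qed
  show "s 0 = 1 \<Longrightarrow> apply_inf (phi w) s 0 = 1 \<and> (Ga \<in> set w \<longrightarrow> apply_inf (phi w) s 1 = 0)"
    using assms(2)
  proof (induction w)
    case Nil
    then show ?case using apply_inf_phi_Nil[OF assms(1)] by simp
  next
    case (Cons x w)
    then show ?case
      using split[OF bin, of x w] keep[of x "apply_inf (phi w) s"]
        keep[of x "suffix 1 (apply_inf (phi w) s)"] bin[of w]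
      by (auto simp: apply_inf_phi_Cons[OF assms(1)] simp del: phi.simps)
  qed
qed

text \<open>The extension \<open>y\<close> can be split off because the pair of generators restricts
  the beginning of \<open>u\<close>: to nothing, to \<open>0\<close>, to \<open>1\<close>, or to one
  of \<open>01\<close> and \<open>10\<close>.\<close>

lemma extended_fixed_if_fixed_point:
  assumes w: "w \<in> index_words m" and u: "fixed_point (phi w) u"
  shows "\<exists>w'. length w' = m \<and> extended_fixed w' u"
proof -
  have u': "binary u" "apply_inf (phi w) u = u" using u by (simp_all add: fixed_point_phi_iff)
  have "\<exists>y\<in>extensions. set w = {conjugate y Gb, conjugate y Gbeta} \<and> (\<exists>c. u = y \<frown> c)"
  proof -
    have u0: "u = [u 0] \<frown> suffix 1 u" by simp
    have u01: "u = [u 0, u 1] \<frown> suffix 2 u"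
      using build_first[of "suffix 1 u"] by (simp add: numeral_2_eq_2)
    consider "set w = {Gb, Gbeta}" | "set w = {Gb, Galpha}" | "set w = {Ga, Gbeta}"
      | "set w = {Ga, Galpha}"
      using w by (auto simp: index_words_def)
    then show ?thesis
    proof cases
      case 1
      then show ?thesis by (intro bexI[of _ "[]"]) (auto simp: extensions_def)
    next
      case 2
      then have "u 0 = 0" using apply_inf_phi_0(1)[OF u'(1), of w] u'(2) by simp
      with u0 2 show ?thesis by (intro bexI[of _ "[0]"]) (auto simp: extensions_def)
    next
      case 3
      then have "u 0 = 1" using apply_inf_phi_0(2)[OF u'(1), of w] u'(2) by simp
      with u0 3 show ?thesis by (intro bexI[of _ "[1]"]) (auto simp: extensions_def)
    next
      case 4
      have "u 0 = 0 \<or> u 0 = 1" using binaryD[OF u'(1), of 0] by linarith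
      then show ?thesis
      proof
        assume "u 0 = 0"
        then have "u 1 = 1" using apply_inf_phi_01(1)[OF u'(1), of w] u'(2) 4 by simp
        with u01 4 \<open>u 0 = 0\<close> show ?thesis
          by (intro bexI[of _ "[0, 1]"]) (auto simp: extensions_def)
      next
        assume "u 0 = 1"
        then have "u 1 = 0" using apply_inf_phi_01(2)[OF u'(1), of w] u'(2) 4 by simp
        with u01 4 \<open>u 0 = 1\<close> show ?thesis
          by (intro bexI[of _ "[1, 0]"]) (auto simp: extensions_def)
      qed
    qed
  qed
  then obtain y c where "y \<in> extensions" "set w = {conjugate y Gb, conjugate y Gbeta}" "u = y \<frown> c"
    by blast
  then have "extended_fixed (map standard w) u" using extended_fixed_standard[OF u] by blast
  then show ?thesis using w by (intro exI[of _ "map standard w"]) (simp add: index_words_def)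
qed

subsection \<open>Primitivity\<close>

lemma set_morph_word_eq: "set (morph_word f w) = (\<Union>a\<in>set w. set (f ! a))"
  by (simp add: morph_word_def)

lemma phi_Cons_nth: "a < 2 \<Longrightarrow> phi (x # w) ! a = morph_word (gen_morph x) (phi w ! a)"
  using bin_morph_phi[of w] by (simp add: compose_def bin_morph_def)

text \<open>Each generator maps a letter to a word containing it, so a letter once present
  persists.\<close>

lemma diag_in_phi: "0 \<in> set (phi w ! 0) \<and> 1 \<in> set (phi w ! 1)"
proof (induction w)
  case (Cons x w)
  then show ?case by (cases x) (force simp: phi_Cons_nth set_morph_word_eq simp del: phi.simps)+
qed simp

lemma zero_in_phi: "set w \<inter> {Ga, Gb} \<noteq> {} \<Longrightarrow> 0 \<in> set (phi w ! 1)"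
proof (induction w)
  case (Cons x w)
  then show ?case using diag_in_phi[of w]
    by (cases x) (force simp: phi_Cons_nth set_morph_word_eq simp del: phi.simps)+
qed simp

lemma one_in_phi: "set w \<inter> {Galpha, Gbeta} \<noteq> {} \<Longrightarrow> 1 \<in> set (phi w ! 0)"
proof (induction w)
  case (Cons x w)
  then show ?case using diag_in_phi[of w]
    by (cases x) (force simp: phi_Cons_nth set_morph_word_eq simp del: phi.simps)+
qed simp

lemma both_in_phi:
  assumes "w \<in> index_words m" "a < 2" "b < 2"
  shows "b \<in> set (phi w ! a)"
proof -
  have "set w \<inter> {Ga, Gb} \<noteq> {}" "set w \<inter> {Galpha, Gbeta} \<noteq> {}"
    using assms(1) unfolding index_words_def by auto
  then show ?thesis
    using zero_in_phi[of w] one_in_phi[of w] diag_in_phi[of w] assms(2,3)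
    unfolding less_2_cases_iff by auto
qed

lemma primitive_phi:
  assumes "w \<in> index_words m"
  shows "primitive (phi w)"
  unfolding primitive_def
proof (intro conjI exI[of _ 1] allI impI)
  fix a b assume "a < length (phi w)" "b < length (phi w)"
  then have "b \<in> set (phi w ! a)"
    using both_in_phi[OF assms] bin_morph_phi[of w] by (simp add: bin_morph_def)
  then show "b \<in> set (morph_pow (phi w) 1 [a])"
    by (simp add: morph_pow_def)
qed (use bin_morph_phi[of w] in \<open>auto simp: bin_morph_def\<close>)

section \<open>Prolongable letters\<close>

lemma hd_morph_word_gen:
  assumes "z \<noteq> []" "set z \<subseteq> {..<2}"
  shows "hd (morph_word (gen_morph x) z) = hd (gen_morph x ! hd z)"
proof (cases z)
  case (Cons a z')
  then have "gen_morph x ! a \<noteq> []" using assms(2) by (intro bin_morph_nth(1)[OF bin_morph_gen]) simp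
  then show ?thesis using Cons by simp
qed (use assms(1) in simp)

lemma hd_phi_Cons:
  assumes "a < 2"
  shows "hd (phi (x # w) ! a) = hd (gen_morph x ! hd (phi w ! a))"
  unfolding phi_Cons_nth[OF assms]
  by (intro hd_morph_word_gen bin_morph_nth[OF bin_morph_phi assms])

lemma hd_phi_less:
  assumes "a < 2"
  shows "hd (phi w ! a) < 2"
proof -
  have "hd (phi w ! a) \<in> set (phi w ! a)" by (intro hd_in_set bin_morph_nth(1)[OF bin_morph_phi assms])
  then show ?thesis using bin_morph_nth(2)[OF bin_morph_phi assms, of w] by auto
qed

text \<open>For \<open>Gb\<close>, \<open>Gbeta\<close> the outermost generator decides, since both
  its images begin with its \<open>lead\<close>. For every other pair there is one letter whose
  images under both generators begin with itself.\<close>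

lemma hd_phi_fixed:
  assumes "w \<in> index_words m"
  shows "\<exists>a<2. hd (phi w ! a) = a"
proof -
  have 0: "hd (phi w ! 0) = 0" if "set w \<subseteq> {Ga, Gb, Galpha}" for w
    using that
  proof (induction w)
    case (Cons x w)
    then show ?case by (cases x) (auto simp: hd_phi_Cons simp del: phi.simps)
  qed simp
  have 1: "hd (phi w ! 1) = 1" if "set w \<subseteq> {Ga, Gbeta}" for w
    using that
  proof (induction w)
    case (Cons x w)
    then show ?case by (cases x) (auto simp: hd_phi_Cons simp del: phi.simps)
  qed simp
  consider "set w = {Gb, Gbeta}" | "set w \<subseteq> {Ga, Gb, Galpha}" | "set w \<subseteq> {Ga, Gbeta}"
    using assms unfolding index_words_def by blast
  then show ?thesis
  proof cases
    case 1
    then obtain x w' where w: "w = x # w'" by (cases w) auto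
    then have "x = Gb \<or> x = Gbeta" using 1 by auto
    then have "hd (phi w ! lead x) = lead x"
      using hd_phi_less[of "lead x" w'] unfolding w
      by (auto simp: hd_phi_Cons less_2_cases_iff simp del: phi.simps)
    then show ?thesis using \<open>x = Gb \<or> x = Gbeta\<close> by (intro exI[of _ "lead x"]) auto
  qed (use 0 1 in \<open>fastforce+\<close>)
qed

text \<open>Each application adds the nonempty \<open>x\<close> and, as \<open>f\<close> is
  non-erasing, does not shorten the rest, so the iterates grow at least linearly.\<close>

lemma is_substitution_if_prolongable:
  assumes f: "bin_morph f" and a: "a < 2" "f ! a = a # x" "x \<noteq> []"
  shows "is_substitution f"
proof -
  have pow: "\<exists>z. morph_pow f n [a] = a # z \<and> n \<le> length z \<and> set z \<subseteq> {..<2}" for n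
  proof (induction n)
    case 0
    show ?case by (simp add: morph_pow_def)
  next
    case (Suc n)
    then obtain z where z: "morph_pow f n [a] = a # z" "n \<le> length z" "set z \<subseteq> {..<2}" by blast
    have "length z \<le> length (morph_word f z)"
      using z(3) bin_morph_nth(1)[OF f] by (intro length_morph_word_ge) auto
    moreover have "length x > 0" using a(3) by simp
    ultimately have "Suc n \<le> length (x @ morph_word f z)" using z(2) unfolding length_append by linarith
    moreover have "set (x @ morph_word f z) \<subseteq> {..<2}"
      using set_morph_word[OF f z(3)] bin_morph_nth(2)[OF f a(1)] a(2) by auto
    moreover have "morph_pow f (Suc n) [a] = a # x @ morph_word f z"
      using z(1) a(2) by (simp add: morph_pow_def)
    ultimately show ?case by blast
  qed
  have "n \<le> length (morph_pow f n [a])" for n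
    using pow[of n] by auto
  then have "filterlim (\<lambda>n. length (morph_pow f n [a])) at_top sequentially"
    by (intro filterlim_at_top_mono[OF filterlim_ident]) simp
  then show ?thesis
    using f a unfolding is_substitution_def bin_morph_def by auto
qed

lemma is_substitution_phi:
  assumes "w \<in> index_words m"
  shows "is_substitution (phi w)"
proof -
  obtain a where a: "a < 2" "hd (phi w ! a) = a" using hd_phi_fixed[OF assms] by blast
  moreover have "0 \<in> set (phi w ! a)" "1 \<in> set (phi w ! a)"
    using both_in_phi[OF assms a(1)] by simp_all
  ultimately obtain x where x: "phi w ! a = a # x" and "0 \<in> set (a # x)" "1 \<in> set (a # x)"
    by (cases "phi w ! a") auto
  then have "x \<noteq> []" by auto
  with a(1) x show ?thesis by (intro is_substitution_if_prolongable[OF bin_morph_phi])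
qed

lemma not_primitive_if_fixed_letter:
  assumes "length f = 2" "a < 2" "f ! a = [a]"
  shows "\<not> primitive f"
proof
  assume "primitive f"
  then obtain n where n: "\<forall>b<2. b \<in> set (morph_pow f n [a])"
    using assms unfolding primitive_def by auto
  have "morph_pow f n [a] = [a]"
    using assms(3) by (induction n) (simp_all add: morph_pow_def)
  then show False using n[rule_format, of 0] n[rule_format, of 1] by simp
qed

text \<open>With only \<open>Ga\<close> and \<open>Gb\<close> the letter \<open>0\<close> stays
  fixed, with only \<open>Galpha\<close> and \<open>Gbeta\<close> the letter \<open>1\<close>;
  either contradicts primitivity.\<close>

lemma primitive_phi_imp_both:
  assumes "primitive (phi w)"
  shows "\<not> set w \<subseteq> {Ga, Gb}" "\<not> set w \<subseteq> {Galpha, Gbeta}"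
proof -
  have "length (phi w) = 2" using bin_morph_phi[of w] by (simp add: bin_morph_def)
  moreover have "set w \<subseteq> {Ga, Gb} \<Longrightarrow> phi w ! 0 = [0]"
  proof (induction w)
    case (Cons x w)
    then show ?case by (auto simp: phi_Cons_nth simp del: phi.simps)
  qed simp
  moreover have "set w \<subseteq> {Galpha, Gbeta} \<Longrightarrow> phi w ! 1 = [1]"
  proof (induction w)
    case (Cons x w)
    then show ?case by (auto simp: phi_Cons_nth simp del: phi.simps)
  qed simp
  ultimately show "\<not> set w \<subseteq> {Ga, Gb}" "\<not> set w \<subseteq> {Galpha, Gbeta}"
    using not_primitive_if_fixed_letter[of "phi w" 0] not_primitive_if_fixed_letter[of "phi w" 1] assms
    by auto
qed

section \<open>The finite closed set\<close>

lemma finite_index_words: "finite (index_words m)"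
proof (rule finite_subset)
  show "index_words m \<subseteq> {w. set w \<subseteq> {Ga, Gb, Galpha, Gbeta} \<and> length w = m}"
    by (auto simp: index_words_def)
qed (simp add: finite_lists_length_eq)

lemma closed_under_derivation_phi: "closed_under_derivation (phi ` index_words m)"
  unfolding closed_under_derivation_def
proof (intro conjI ballI allI impI)
  fix \<phi> u v assume "\<phi> \<in> phi ` index_words m" "fixed_point \<phi> u" "is_factor v u"
  then obtain w where "extended_fixed w u" "length w = m"
    using extended_fixed_if_fixed_point by blast
  then obtain w' d where d: "length w' = m" "extended_fixed w' d" "codes_returns u v d"
    using extended_fixed_derived[OF _ \<open>is_factor v u\<close>] by blast
  then show "\<exists>\<psi>\<in>phi ` index_words m. derived_fixed_by u v \<psi>"
    using fixed_point_if_extended_fixed[OF d(2)] derived_fixed_by_if_codes_returns by blast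
qed (auto simp: finite_index_words primitive_phi is_substitution_phi)

theorem theorem24:
  fixes w :: "gen list"
  assumes "is_substitution (phi w)"
    and "primitive (phi w)"
    and "set w \<subseteq> {Gb, Gbeta} \<or> set w \<subseteq> {Gb, Galpha} \<or>
         set w \<subseteq> {Ga, Gbeta} \<or> set w \<subseteq> {Ga, Galpha}"
  shows "closeable_under_derivation (phi w)"
proof -
  \<comment> \<open>Primitivity turns the inclusion of \<open>set w\<close> in a pair into
    equality.\<close>
  have "w \<in> index_words (length w)"
    using assms(3) primitive_phi_imp_both[OF assms(2)] unfolding index_words_def by blast
  then show ?thesis
    unfolding closeable_under_derivation_def using closed_under_derivation_phi by blast
qed

end
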